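(* The optimal value of the problem $(CP)$ is equal to the optimal value of the following semi-definite program: $$(SDP)\quad \min\ \langle Q,X\rangle + c^T x$$ subject to (i) $X_{ii}-x_i=0$ for all $i\in I\cup J$; (ii) $-X_{ij}+x_i=0$ for all $(i,j)\in J\times(I\cup J)$ with $\mathcal{E}_j\subset\mathcal{E}_i$; (iii) $-X_{jk}+x_i=0$ for all $(i,j,k)\in J\times(I\cup J)^2$ with $\mathcal{E}_i=\mathcal{E}_j\cup\mathcal{E}_k$; (iv) $X_{ij}-X_{kl}=0$ for all $(i,j,k,l)\in(I\cup J)^4$ with $\mathcal{E}_i\cup\mathcal{E}_j=\mathcal{E}_k\cup\mathcal{E}_l$; (v) $\begin{pmatrix}1 & x^T\\ x & X\end{pmatrix}\succeq 0$; (vi) $x\in\mathbb{R}^N$, $X\in S^N$. Moreover, optimal values $(\alpha^*,\beta^*,\delta^*,\lambda^* )$ of $(CP)$ are given by the optimal values of the dual variables associated with constraints (i)–(iv) respectively.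
   Context: Consider the unconstrained binary polynomial problem $(P)$: $\min f(x)=\sum_{p=1}^m c_p\prod_{i\in\mathcal{M}_p}x_i$ over $x\in\{0,1\}^n$, with $I=\{1,\dots,n\}$. A quadratization introduces additional variables indexed by $J=\{n+1,\dots,N\}$; for $i\in I$, $\mathcal{E}_i=\{i\}$, and for $i\in J$ the variable $x_i$ replaces a product $x_{i_1}x_{i_2}$ with $(i_1,i_2)\in(I\cup J)^2$ and $\mathcal{E}_i=\mathcal{E}_{i_1}\cup\mathcal{E}_{i_2}$; every monomial of degree at least 3 is written as $x_jx_k$ with $\mathcal{M}_p=\mathcal{E}_j\cup\mathcal{E}_k$. Let $\mathcal{F}_{\mathcal{E}}$ be the set of $x\in\{0,1\}^N$ satisfying, for every $(i,i_1,i_2)\in J\times(I\cup J)^2$ with $\mathcal{E}_i=\mathcal{E}_{i_1}\cup\mathcal{E}_{i_2}$, the Fortet inequalities $x_i\le x_{i_1}$, $x_i\le x_{i_2}$, $x_i\ge x_{i_1}+x_{i_2}-1$, $x_i\ge 0$. This gives the equivalent problem $(QP)$: $\min g(x)=x^TQx+c^Tx$ s.t. $x\in\mathcal{F}_{\mathcal{E}}$, with $Q\in S_N$ (real symmetric $N\times N$ matrices), $c\in\mathbb{R}^N$. For real parameters $\alpha_i$, $\beta_{ij}$, $\delta_{ijk}$, $\lambda_{ijkl}$ define $g_{\alpha,\beta,\delta,\lambda}(x)=g(x)+\sum_{i\in I\cup J}\alpha_i(x_i^2-x_i)+\sum_{(i,j)\in J\times(I\cup J),\,\mathcal{E}_j\subset\mathcal{E}_i}\beta_{ij}(x_i-x_ix_j)+\sum_{(i,j,k)\in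 J\times(I\cup J)^2,\,\mathcal{E}_i=\mathcal{E}_j\cup\mathcal{E}_k}\delta_{ijk}(x_i-x_jx_k)+\sum_{(i,j,k,l)\in(I\cup J)^4,\,\mathcal{E}_i\cup\mathcal{E}_j=\mathcal{E}_k\cup\mathcal{E}_l}\lambda_{ijkl}(x_ix_j-x_kx_l)$, which equals $g$ on $\mathcal{F}_{\mathcal{E}}$; let $Q_{\alpha,\beta,\delta,\lambda}$ be its Hessian (quadratic-form matrix). With $T_1,T_2,T_3$ the numbers of $\beta$, $\delta$, $\lambda$ parameters, $(CP)$ is the problem $\max_{\alpha\in\mathbb{R}^N,\beta\in\mathbb{R}^{T_1},\delta\in\mathbb{R}^{T_2},\lambda\in\mathbb{R}^{T_3},\,Q_{\alpha,\beta,\delta,\lambda}\succeq 0}\ \min_{x\in\overline{\mathcal{F}}_{\mathcal{E}}} g_{\alpha,\beta,\delta,\lambda}(x)$, where $\overline{\mathcal{F}}_{\mathcal{E}}$ is $\mathcal{F}_{\mathcal{E}}$ with $x\in\{0,1\}^N$ relaxed to $x\in[0,1]^N$. *)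

theory Defs
  imports "HOL-Analysis.Analysis"
begin

text \<open>
  The variables are indexed by a finite type \<open>'v\<close>, so that \<open>N = CARD('v)\<close>. The set \<open>I\<close> holds the
  original variables; its complement \<open>J = - I\<close> holds the additional ones and may be empty.
\<close>

text \<open>
  For \<open>i \<in> J\<close> the variable \<open>x\<^sub>i\<close> replaces the product of the two variables \<open>fac i\<close>. Well-foundedness
  says that the additional variables can be introduced one after the other; it makes the
  recursive equations determine \<open>E\<close> uniquely.
\<close>

definition quadratization :: "'v::finite set \<Rightarrow> ('v \<Rightarrow> 'v \<times> 'v) \<Rightarrow> ('v \<Rightarrow> 'v set) \<Rightarrow> bool" where
  "quadratization I fac E \<longleftrightarrow>
     wf {(k, i). i \<in> - I \<and> (k = fst (fac i) \<or> k = snd (fac i))} \<and>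
     (\<forall>i\<in>I. E i = {i}) \<and>
     (\<forall>i\<in>- I. E i = E (fst (fac i)) \<union> E (snd (fac i)))"

definition Jbeta :: "'v::finite set \<Rightarrow> ('v \<Rightarrow> 'v set) \<Rightarrow> ('v \<times> 'v) set" where
  "Jbeta I E = {(i, j). i \<in> - I \<and> E j \<subset> E i}"

definition Jdelta :: "'v::finite set \<Rightarrow> ('v \<Rightarrow> 'v set) \<Rightarrow> ('v \<times> 'v \<times> 'v) set" where
  "Jdelta I E = {(i, j, k). i \<in> - I \<and> E i = E j \<union> E k}"

definition Jlambda :: "('v::finite \<Rightarrow> 'v set) \<Rightarrow> ('v \<times> 'v \<times> 'v \<times> 'v) set" where
  "Jlambda E = {(i, j, k, l). E i \<union> E j = E k \<union> E l}"

definition fortet :: "'v::finite set \<Rightarrow> ('v \<Rightarrow> 'v set) \<Rightarrow> real^'v \<Rightarrow> bool" where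
  "fortet I E x \<longleftrightarrow>
     (\<forall>(i, i1, i2)\<in>Jdelta I E.
        x $ i \<le> x $ i1 \<and> x $ i \<le> x $ i2 \<and> x $ i \<ge> x $ i1 + x $ i2 - 1 \<and> x $ i \<ge> 0)"

definition F_bin :: "'v::finite set \<Rightarrow> ('v \<Rightarrow> 'v set) \<Rightarrow> (real^'v) set" where
  "F_bin I E = {x. (\<forall>i. x $ i \<in> {0, 1}) \<and> fortet I E x}"

definition F_relax :: "'v::finite set \<Rightarrow> ('v \<Rightarrow> 'v set) \<Rightarrow> (real^'v) set" where
  "F_relax I E = {x. (\<forall>i. x $ i \<in> {0..1}) \<and> fortet I E x}"

text \<open>The polynomial with monomials \<open>M p \<subseteq> I\<close>; it reads only the components of \<open>x\<close> in \<open>I\<close>.\<close>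

definition f_obj :: "nat \<Rightarrow> (nat \<Rightarrow> real) \<Rightarrow> (nat \<Rightarrow> 'v::finite set) \<Rightarrow> real^'v \<Rightarrow> real" where
  "f_obj m coef M x = (\<Sum>p=1..m. coef p * (\<Prod>i\<in>M p. x $ i))"

definition g_obj :: "real^'v^'v \<Rightarrow> real^'v \<Rightarrow> real^'v::finite \<Rightarrow> real" where
  "g_obj Q c x = x \<bullet> (Q *v x) + c \<bullet> x"

text \<open>
  The multipliers \<open>\<beta>\<close>, \<open>\<delta>\<close>, \<open>\<lambda>\<close> (here \<open>lam\<close>) are total functions, of which only the values on
  \<^term>\<open>Jbeta\<close>, \<^term>\<open>Jdelta\<close>, \<^term>\<open>Jlambda\<close> are ever used.
\<close>

definition g_par ::
  "'v::finite set \<Rightarrow> ('v \<Rightarrow> 'v set) \<Rightarrow> real^'v^'v \<Rightarrow> real^'v \<Rightarrow>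
   ('v \<Rightarrow> real) \<Rightarrow> ('v \<Rightarrow> 'v \<Rightarrow> real) \<Rightarrow> ('v \<Rightarrow> 'v \<Rightarrow> 'v \<Rightarrow> real) \<Rightarrow> ('v \<Rightarrow> 'v \<Rightarrow> 'v \<Rightarrow> 'v \<Rightarrow> real) \<Rightarrow>
   real^'v \<Rightarrow> real" where
  "g_par I E Q c \<alpha> \<beta> \<delta> lam x =
     g_obj Q c x
     + (\<Sum>i\<in>UNIV. \<alpha> i * ((x $ i)\<^sup>2 - x $ i))
     + (\<Sum>(i, j)\<in>Jbeta I E. \<beta> i j * (x $ i - x $ i * x $ j))
     + (\<Sum>(i, j, k)\<in>Jdelta I E. \<delta> i j k * (x $ i - x $ j * x $ k))
     + (\<Sum>(i, j, k, l)\<in>Jlambda E. lam i j k l * (x $ i * x $ j - x $ k * x $ l))"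

text \<open>The symmetric matrix of the quadratic form \<open>x\<^sub>i x\<^sub>j\<close>.\<close>

definition sym_unit :: "'v \<Rightarrow> 'v \<Rightarrow> real^'v^'v::finite" where
  "sym_unit i j = (\<chi> a b. (of_bool (a = i \<and> b = j) + of_bool (a = j \<and> b = i)) / 2)"

definition Q_par ::
  "'v::finite set \<Rightarrow> ('v \<Rightarrow> 'v set) \<Rightarrow> real^'v^'v \<Rightarrow>
   ('v \<Rightarrow> real) \<Rightarrow> ('v \<Rightarrow> 'v \<Rightarrow> real) \<Rightarrow> ('v \<Rightarrow> 'v \<Rightarrow> 'v \<Rightarrow> real) \<Rightarrow> ('v \<Rightarrow> 'v \<Rightarrow> 'v \<Rightarrow> 'v \<Rightarrow> real) \<Rightarrow>
   real^'v^'v" where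
  "Q_par I E Q \<alpha> \<beta> \<delta> lam =
     Q
     + (\<Sum>i\<in>UNIV. \<alpha> i *\<^sub>R sym_unit i i)
     + (\<Sum>(i, j)\<in>Jbeta I E. - \<beta> i j *\<^sub>R sym_unit i j)
     + (\<Sum>(i, j, k)\<in>Jdelta I E. - \<delta> i j k *\<^sub>R sym_unit j k)
     + (\<Sum>(i, j, k, l)\<in>Jlambda E. lam i j k l *\<^sub>R (sym_unit i j - sym_unit k l))"

lemma transpose_sum': "transpose (\<Sum>a\<in>A. F a) = (\<Sum>a\<in>A. transpose (F a :: real^'v::finite^'v))"
  by (simp add: transpose_def vec_eq_iff)

lemma transpose_sym_unit: "transpose (sym_unit i j) = sym_unit i j"
  by (simp only: transpose_def sym_unit_def vec_eq_iff vec_lambda_beta)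
    (simp only: conj_commute add.commute simp_thms)

lemma inner_sym_unit: "x \<bullet> (sym_unit i j *v x) = x $ i * x $ j"
proof -
  have delta: "(\<Sum>a\<in>UNIV. \<Sum>b\<in>UNIV. of_bool (a = p \<and> b = q) * (x $ a * x $ b)) = x $ p * x $ q"
    for p q
  proof -
    have "(\<Sum>b\<in>UNIV. of_bool (a = p \<and> b = q) * (x $ a * x $ b))
        = (if a = p then x $ a * x $ q else 0)" for a
      by (simp add: of_bool_conj of_bool_def if_distrib [where f="\<lambda>z. z * _"] cong: if_cong)
    thus ?thesis by simp
  qed
  have "x \<bullet> (sym_unit i j *v x) =
    (\<Sum>a\<in>UNIV. \<Sum>b\<in>UNIV. of_bool (a = i \<and> b = j) * (x $ a * x $ b) / 2
       + of_bool (a = j \<and> b = i) * (x $ a * x $ b) / 2)"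
    unfolding inner_vec_def matrix_vector_mult_def sym_unit_def
    by (simp only: vec_lambda_beta inner_real_def sum_distrib_left)
      (intro sum.cong refl, simp add: field_simps)
  also have "\<dots> = x $ i * x $ j"
    by (simp only: sum.distrib sum_divide_distrib [symmetric] delta) simp
  finally show ?thesis .
qed

lemma transpose_Q_par:
  assumes "transpose Q = Q"
  shows "transpose (Q_par I E Q \<alpha> \<beta> \<delta> lam) = Q_par I E Q \<alpha> \<beta> \<delta> lam"
proof -
  have sc: "transpose (r *\<^sub>R A) = r *\<^sub>R transpose A" for r and A :: "real^'a^'a"
    by (simp add: transpose_def vec_eq_iff)
  have ad: "transpose (A + B) = transpose A + transpose B" for A B :: "real^'a^'a"
    by (simp add: transpose_def vec_eq_iff)
  have df: "transpose (A - B) = transpose A - transpose B" for A B :: "real^'a^'a"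
    by (simp add: transpose_def vec_eq_iff)
  show ?thesis
    by (simp only: Q_par_def ad df transpose_sum' case_prod_unfold sc transpose_sym_unit assms)
qed

text \<open>\<^term>\<open>Q_par\<close> is the quadratic-form matrix of \<^term>\<open>g_par\<close>.\<close>

lemma g_par_quadratic_form:
  "\<exists>d. \<forall>x. g_par I E Q c \<alpha> \<beta> \<delta> lam x = x \<bullet> (Q_par I E Q \<alpha> \<beta> \<delta> lam *v x) + d \<bullet> x"
proof -
  define qf where "qf A x = x \<bullet> (A *v x)" for A :: "real^'a^'a" and x
  define d where "d = c - (\<Sum>i\<in>UNIV. \<alpha> i *\<^sub>R axis i 1)
     + (\<Sum>(i, j)\<in>Jbeta I E. \<beta> i j *\<^sub>R axis i 1)
     + (\<Sum>(i, j, k)\<in>Jdelta I E. \<delta> i j k *\<^sub>R axis i 1)"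
  have ad: "qf (A + B) x = qf A x + qf B x" for A B x
    by (simp only: qf_def matrix_vector_mult_add_rdistrib inner_add_right)
  have df: "qf (A - B) x = qf A x - qf B x" for A B x
    by (simp only: qf_def matrix_vector_mult_diff_rdistrib inner_diff_right)
  have sc: "qf (r *\<^sub>R A) x = r * qf A x" for r A x
    by (simp only: qf_def scaleR_matrix_vector_assoc [symmetric] inner_scaleR_right)
  have z: "qf 0 x = 0" for x
    by (simp add: qf_def)
  have sm: "qf (sum F S) x = (\<Sum>a\<in>S. qf (F a) x)" for F :: "'b \<Rightarrow> real^'a^'a" and S x
    by (induction S rule: infinite_finite_induct) (simp_all add: z ad)
  have un: "qf (sym_unit i j) x = x $ i * x $ j" for i j x
    by (simp only: qf_def inner_sym_unit)
  have ax: "axis i (1::real) \<bullet> x = x $ i" for i and x :: "real^'a"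
    by (simp add: inner_axis')
  have "g_par I E Q c \<alpha> \<beta> \<delta> lam x = qf (Q_par I E Q \<alpha> \<beta> \<delta> lam) x + d \<bullet> x" for x
  proof -
    have 1: "(\<Sum>i\<in>UNIV. \<alpha> i * ((x $ i)\<^sup>2 - x $ i)) =
        (\<Sum>i\<in>UNIV. \<alpha> i * (x $ i * x $ i)) - (\<Sum>i\<in>UNIV. \<alpha> i * x $ i)"
      by (simp only: right_diff_distrib sum_subtractf power2_eq_square)
    have 2: "(\<Sum>(i, j)\<in>Jbeta I E. \<beta> i j * (x $ i - x $ i * x $ j)) =
        (\<Sum>(i, j)\<in>Jbeta I E. \<beta> i j * x $ i) + (\<Sum>(i, j)\<in>Jbeta I E. - \<beta> i j * (x $ i * x $ j))"
      unfolding sum.distrib [symmetric] by (intro sum.cong refl) (auto simp: algebra_simps)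
    have 3: "(\<Sum>(i, j, k)\<in>Jdelta I E. \<delta> i j k * (x $ i - x $ j * x $ k)) =
        (\<Sum>(i, j, k)\<in>Jdelta I E. \<delta> i j k * x $ i)
        + (\<Sum>(i, j, k)\<in>Jdelta I E. - \<delta> i j k * (x $ j * x $ k))"
      unfolding sum.distrib [symmetric] by (intro sum.cong refl) (auto simp: algebra_simps)
    have Q: "qf (Q_par I E Q \<alpha> \<beta> \<delta> lam) x = qf Q x
        + (\<Sum>i\<in>UNIV. \<alpha> i * (x $ i * x $ i))
        + (\<Sum>(i, j)\<in>Jbeta I E. - \<beta> i j * (x $ i * x $ j))
        + (\<Sum>(i, j, k)\<in>Jdelta I E. - \<delta> i j k * (x $ j * x $ k))
        + (\<Sum>(i, j, k, l)\<in>Jlambda E. lam i j k l * (x $ i * x $ j - x $ k * x $ l))"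
      by (simp only: Q_par_def ad sm sc df un case_prod_unfold)
    have d: "d \<bullet> x = c \<bullet> x - (\<Sum>i\<in>UNIV. \<alpha> i * x $ i) + (\<Sum>(i, j)\<in>Jbeta I E. \<beta> i j * x $ i)
        + (\<Sum>(i, j, k)\<in>Jdelta I E. \<delta> i j k * x $ i)"
      by (simp only: d_def inner_add_left inner_diff_left inner_sum_left inner_scaleR_left ax
          case_prod_unfold)
    show ?thesis
      unfolding g_par_def g_obj_def 1 2 3 Q d qf_def [of Q] by linarith
  qed
  thus ?thesis unfolding qf_def by blast
qed

definition psd :: "real^'a^'a::finite \<Rightarrow> bool" where
  "psd A \<longleftrightarrow> transpose A = A \<and> (\<forall>v. 0 \<le> v \<bullet> (A *v v))"

definition CP_obj ::
  "'v::finite set \<Rightarrow> ('v \<Rightarrow> 'v set) \<Rightarrow> real^'v^'v \<Rightarrow> real^'v \<Rightarrow>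
   ('v \<Rightarrow> real) \<Rightarrow> ('v \<Rightarrow> 'v \<Rightarrow> real) \<Rightarrow> ('v \<Rightarrow> 'v \<Rightarrow> 'v \<Rightarrow> real) \<Rightarrow> ('v \<Rightarrow> 'v \<Rightarrow> 'v \<Rightarrow> 'v \<Rightarrow> real) \<Rightarrow>
   ereal" where
  "CP_obj I E Q c \<alpha> \<beta> \<delta> lam = (INF x\<in>F_relax I E. ereal (g_par I E Q c \<alpha> \<beta> \<delta> lam x))"

definition CP_value :: "'v::finite set \<Rightarrow> ('v \<Rightarrow> 'v set) \<Rightarrow> real^'v^'v \<Rightarrow> real^'v \<Rightarrow> ereal" where
  "CP_value I E Q c =
     (SUP (\<alpha>, \<beta>, \<delta>, lam)\<in>{(\<alpha>, \<beta>, \<delta>, lam). psd (Q_par I E Q \<alpha> \<beta> \<delta> lam)}.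
        CP_obj I E Q c \<alpha> \<beta> \<delta> lam)"

definition CP_optimal ::
  "'v::finite set \<Rightarrow> ('v \<Rightarrow> 'v set) \<Rightarrow> real^'v^'v \<Rightarrow> real^'v \<Rightarrow>
   ('v \<Rightarrow> real) \<Rightarrow> ('v \<Rightarrow> 'v \<Rightarrow> real) \<Rightarrow> ('v \<Rightarrow> 'v \<Rightarrow> 'v \<Rightarrow> real) \<Rightarrow> ('v \<Rightarrow> 'v \<Rightarrow> 'v \<Rightarrow> 'v \<Rightarrow> real) \<Rightarrow>
   bool" where
  "CP_optimal I E Q c \<alpha> \<beta> \<delta> lam \<longleftrightarrow>
     psd (Q_par I E Q \<alpha> \<beta> \<delta> lam) \<and> CP_obj I E Q c \<alpha> \<beta> \<delta> lam = CP_value I E Q c"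

text \<open>The bordered matrix with first row \<open>(1, x\<^sup>T)\<close>; the index \<^term>\<open>None\<close> is the additional one.\<close>

definition bordered :: "real^'v \<Rightarrow> real^'v^'v \<Rightarrow> real^('v::finite option)^('v option)" where
  "bordered x X = (\<chi> a b. case (a, b) of
       (None, None) \<Rightarrow> 1
     | (None, Some j) \<Rightarrow> x $ j
     | (Some i, None) \<Rightarrow> x $ i
     | (Some i, Some j) \<Rightarrow> X $ i $ j)"

text \<open>On \<^typ>\<open>real^'v^'v\<close> the inner product is the Frobenius product \<open>\<langle>Q, X\<rangle>\<close>.\<close>

definition SDP_obj :: "real^'v^'v \<Rightarrow> real^'v \<Rightarrow> real^'v \<Rightarrow> real^'v^'v::finite \<Rightarrow> real" where
  "SDP_obj Q c x X = Q \<bullet> X + c \<bullet> x"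

definition SDP_feasible ::
  "'v::finite set \<Rightarrow> ('v \<Rightarrow> 'v set) \<Rightarrow> real^'v \<Rightarrow> real^'v^'v \<Rightarrow> bool" where
  "SDP_feasible I E x X \<longleftrightarrow>
     (\<forall>i. X $ i $ i - x $ i = 0) \<and>
     (\<forall>(i, j)\<in>Jbeta I E. - X $ i $ j + x $ i = 0) \<and>
     (\<forall>(i, j, k)\<in>Jdelta I E. - X $ j $ k + x $ i = 0) \<and>
     (\<forall>(i, j, k, l)\<in>Jlambda E. X $ i $ j - X $ k $ l = 0) \<and>
     psd (bordered x X) \<and>
     transpose X = X"

definition SDP_value :: "'v::finite set \<Rightarrow> ('v \<Rightarrow> 'v set) \<Rightarrow> real^'v^'v \<Rightarrow> real^'v \<Rightarrow> ereal" where
  "SDP_value I E Q c = (INF (x, X)\<in>{(x, X). SDP_feasible I E x X}. ereal (SDP_obj Q c x X))"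

definition SDP_optimal ::
  "'v::finite set \<Rightarrow> ('v \<Rightarrow> 'v set) \<Rightarrow> real^'v^'v \<Rightarrow> real^'v \<Rightarrow> real^'v \<Rightarrow> real^'v^'v \<Rightarrow> bool" where
  "SDP_optimal I E Q c x X \<longleftrightarrow>
     SDP_feasible I E x X \<and> ereal (SDP_obj Q c x X) = SDP_value I E Q c"

text \<open>
  \<open>\<alpha>\<close>, \<open>\<beta>\<close>, \<open>\<delta>\<close>, \<open>lam\<close> multiply the left-hand sides of the four families of equations exactly as
  they are written in \<^term>\<open>SDP_feasible\<close>, and a positive semidefinite matrix \<open>S\<close> is the multiplier
  of the semidefinite constraint.
\<close>

definition SDP_lagrangian ::
  "'v::finite set \<Rightarrow> ('v \<Rightarrow> 'v set) \<Rightarrow> real^'v^'v \<Rightarrow> real^'v \<Rightarrow>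
   ('v \<Rightarrow> real) \<Rightarrow> ('v \<Rightarrow> 'v \<Rightarrow> real) \<Rightarrow> ('v \<Rightarrow> 'v \<Rightarrow> 'v \<Rightarrow> real) \<Rightarrow> ('v \<Rightarrow> 'v \<Rightarrow> 'v \<Rightarrow> 'v \<Rightarrow> real) \<Rightarrow>
   real^('v option)^('v option) \<Rightarrow> real^'v \<Rightarrow> real^'v^'v \<Rightarrow> real" where
  "SDP_lagrangian I E Q c \<alpha> \<beta> \<delta> lam S x X =
     SDP_obj Q c x X
     + (\<Sum>i\<in>UNIV. \<alpha> i * (X $ i $ i - x $ i))
     + (\<Sum>(i, j)\<in>Jbeta I E. \<beta> i j * (- X $ i $ j + x $ i))
     + (\<Sum>(i, j, k)\<in>Jdelta I E. \<delta> i j k * (- X $ j $ k + x $ i))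
     + (\<Sum>(i, j, k, l)\<in>Jlambda E. lam i j k l * (X $ i $ j - X $ k $ l))
     - S \<bullet> bordered x X"

definition SDP_dual_obj ::
  "'v::finite set \<Rightarrow> ('v \<Rightarrow> 'v set) \<Rightarrow> real^'v^'v \<Rightarrow> real^'v \<Rightarrow>
   ('v \<Rightarrow> real) \<Rightarrow> ('v \<Rightarrow> 'v \<Rightarrow> real) \<Rightarrow> ('v \<Rightarrow> 'v \<Rightarrow> 'v \<Rightarrow> real) \<Rightarrow> ('v \<Rightarrow> 'v \<Rightarrow> 'v \<Rightarrow> 'v \<Rightarrow> real) \<Rightarrow>
   real^('v option)^('v option) \<Rightarrow> ereal" where
  "SDP_dual_obj I E Q c \<alpha> \<beta> \<delta> lam S =
     (INF (x, X)\<in>{(x, X). transpose X = X}. ereal (SDP_lagrangian I E Q c \<alpha> \<beta> \<delta> lam S x X))"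

definition SDP_dual_optimal ::
  "'v::finite set \<Rightarrow> ('v \<Rightarrow> 'v set) \<Rightarrow> real^'v^'v \<Rightarrow> real^'v \<Rightarrow>
   ('v \<Rightarrow> real) \<Rightarrow> ('v \<Rightarrow> 'v \<Rightarrow> real) \<Rightarrow> ('v \<Rightarrow> 'v \<Rightarrow> 'v \<Rightarrow> real) \<Rightarrow> ('v \<Rightarrow> 'v \<Rightarrow> 'v \<Rightarrow> 'v \<Rightarrow> real) \<Rightarrow>
   real^('v option)^('v option) \<Rightarrow> bool" where
  "SDP_dual_optimal I E Q c \<alpha> \<beta> \<delta> lam S \<longleftrightarrow>
     psd S \<and>
     (\<forall>\<alpha>' \<beta>' \<delta>' lam' S'. psd S' \<longrightarrow>
        SDP_dual_obj I E Q c \<alpha>' \<beta>' \<delta>' lam' S' \<le> SDP_dual_obj I E Q c \<alpha> \<beta> \<delta> lam S)"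

end

theory Submission
  imports Defs
begin

text \<open>
  Label the border index by \<open>{}\<close> and the index \<open>i\<close> by \<open>E i\<close>. The equations of (SDP) then say that an entry
  \<open>(a, b)\<close> of the bordered matrix depends only on the union of the labels of \<open>a\<close> and \<open>b\<close>, that is, the
  feasible matrices are the positive semidefinite moment matrices \<open>M(y)\<close> with \<open>y\<^sub>\<emptyset> = 1\<close>.

  Strong duality: the adjoint of \<open>M\<close> maps the positive semidefinite cone onto the cone generated by
  squares of multilinear polynomials modulo \<open>x\<^sub>i\<^sup>2 = x\<^sub>i\<close>. This cone is closed, even though coinciding
  labels may destroy strict feasibility, so a separation argument produces dual multipliers that
  attain the primal optimum, which itself is attained by compactness.

  For (CP): at the pair \<open>(x, x x\<^sup>T)\<close> the Lagrangian is at most \<open>g\<^sub>\<alpha>\<^sub>\<beta>\<^sub>\<delta>\<^sub>\<lambda>(x)\<close>, so the dual value bounds the convex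
  function from below on the whole space, which also makes its matrix positive semidefinite.
  Conversely, a feasible \<open>(x, X)\<close> satisfies the Fortet inequalities, and \<open>X - x x\<^sup>T \<succeq> 0\<close> gives
  \<open>g\<^sub>\<alpha>\<^sub>\<beta>\<^sub>\<delta>\<^sub>\<lambda>(x) \<le> \<langle>Q, X\<rangle> + c\<^sup>T x\<close>.
\<close>

subsection \<open>Positive semidefinite matrices\<close>

definition outer :: "real^'a \<Rightarrow> real^'a^'a" where
  "outer v = (\<chi> a b. v $ a * v $ b)"

lemma inner_matrix: "A \<bullet> B = (\<Sum>a\<in>UNIV. \<Sum>b\<in>UNIV. A $ a $ b * B $ a $ b)"
  for A B :: "real^'b::finite^'a::finite"
  by (simp add: inner_vec_def)

lemma quadratic_form_sum:
  "v \<bullet> (A *v v) = (\<Sum>a\<in>UNIV. \<Sum>b\<in>UNIV. A $ a $ b * (v $ a * v $ b))"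
  for A :: "real^'a::finite^'a"
  by (simp add: inner_vec_def matrix_vector_mult_def sum_distrib_left mult_ac)

lemma inner_outer: "A \<bullet> outer v = v \<bullet> (A *v v)"
  by (simp add: quadratic_form_sum inner_matrix outer_def)

lemma transpose_eq_entry: "transpose A = A \<Longrightarrow> A $ a $ b = A $ b $ a"
  unfolding transpose_def by (metis vec_lambda_beta)

lemma psd_entry_sym: "psd A \<Longrightarrow> A $ a $ b = A $ b $ a"
  unfolding psd_def by (blast dest: transpose_eq_entry)

lemma quadratic_form_outer: "w \<bullet> (outer v *v w) = (v \<bullet> w)\<^sup>2"
  unfolding quadratic_form_sum
  by (simp add: outer_def inner_vec_def power2_eq_square sum_product mult_ac)

lemma psd_outer: "psd (outer v)"
  unfolding psd_def quadratic_form_outer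
  by (simp add: transpose_def outer_def vec_eq_iff mult.commute)

lemma psd_zero: "psd 0"
  by (simp add: psd_def transpose_def vec_eq_iff)

lemma psd_add: "psd A \<Longrightarrow> psd B \<Longrightarrow> psd (A + B)"
  by (simp add: psd_def transpose_def vec_eq_iff matrix_vector_mult_add_rdistrib inner_add_right)

lemma psd_scaleR: "psd A \<Longrightarrow> 0 \<le> r \<Longrightarrow> psd (r *\<^sub>R A)"
  by (simp add: psd_def transpose_def vec_eq_iff flip: scaleR_matrix_vector_assoc)

lemma axis_quadratic_form: "axis a 1 \<bullet> (A *v axis b 1) = A $ a $ b"
  for A :: "real^'a::finite^'a"
proof -
  have "(A *v axis b 1) $ a = A $ a $ b"
    by (simp add: matrix_vector_mult_def axis_def if_distrib cong: if_cong)
  then show ?thesis by (simp add: inner_axis')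
qed

lemma psd_principal_2:
  assumes "psd A"
  shows "0 \<le> s\<^sup>2 * A $ a $ a + 2 * s * t * A $ a $ b + t\<^sup>2 * A $ b $ b"
proof -
  let ?v = "s *\<^sub>R axis a 1 + t *\<^sub>R axis b 1"
  have "0 \<le> ?v \<bullet> (A *v ?v)" using assms unfolding psd_def by blast
  then show ?thesis
    by (simp add: matrix_vector_right_distrib matrix_vector_mult_scaleR inner_add_left inner_add_right
        axis_quadratic_form psd_entry_sym[OF assms, of b a] power2_eq_square algebra_simps)
qed

lemma psd_diag_nonneg: "psd A \<Longrightarrow> 0 \<le> A $ a $ a"
  unfolding psd_def by (metis axis_quadratic_form)

text \<open>A suitable pair \<open>(s, t)\<close> in \<open>psd_principal_2\<close> extracts the 2x2
  determinant; a zero diagonal entry needs a separate choice.\<close>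

lemma psd_minor:
  assumes "psd A"
  shows "(A $ a $ b)\<^sup>2 \<le> A $ a $ a * A $ b $ b"
proof -
  let ?p = "A $ a $ a" and ?q = "A $ a $ b" and ?r = "A $ b $ b"
  have p: "0 \<le> ?p" "0 \<le> ?r" using psd_diag_nonneg[OF assms] by auto
  show ?thesis
  proof (cases "?r = 0")
    case True
    have "0 \<le> (?q)\<^sup>2 * ?p + 2 * ?q * t * ?q + t\<^sup>2 * ?r" for t
      by (rule psd_principal_2[OF assms])
    \<comment> \<open>With \<open>?r = 0\<close> the form is \<open>?q^2 * (?p + 2 * t)\<close>;
      this \<open>t\<close> makes the bracket -2.\<close>
    from this[of "- ?p / 2 - 1"] have "0 \<le> - (2 * ?q\<^sup>2)"
      using True by (simp add: power2_eq_square algebra_simps)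
    then show ?thesis using True by simp
  next
    case nz: False
    \<comment> \<open>The pair \<open>(?r, - ?q)\<close> turns the form into \<open>?r\<close> times
      the determinant.\<close>
    have "0 \<le> ?r\<^sup>2 * ?p + 2 * ?r * (- ?q) * ?q + (- ?q)\<^sup>2 * ?r"
      by (rule psd_principal_2[OF assms])
    then have "0 \<le> ?r * (?p * ?r - ?q\<^sup>2)"
      by (simp add: power2_eq_square algebra_simps)
    then show ?thesis using nz p by (simp add: zero_le_mult_iff)
  qed
qed

text \<open>One step of symmetric Gaussian elimination, which clears row and column
  \<open>k\<close>.\<close>

lemma psd_pivot:
  assumes "psd A" "0 < A $ k $ k"
  shows "psd (A - (1 / A $ k $ k) *\<^sub>R outer (A $ k))"
proof -
  let ?p = "A $ k $ k" and ?B = "A - (1 / A $ k $ k) *\<^sub>R outer (A $ k)"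
  have sym: "A $ a $ b = A $ b $ a" for a b
    by (rule psd_entry_sym[OF assms(1)])
  have "0 \<le> v \<bullet> (?B *v v)" for v
  proof -
    let ?s = "A $ k \<bullet> v"
    \<comment> \<open>\<open>w\<close> minimizes the form of \<open>A\<close> on the line through
      \<open>v\<close> in direction \<open>axis k 1\<close>; the minimum is the reduced form at
      \<open>v\<close>.\<close>
    define w where "w = v - (?s / ?p) *\<^sub>R axis k 1"
    have Ax: "A *v axis k 1 = A $ k"
      using sym by (simp add: matrix_vector_mult_def axis_def vec_eq_iff if_distrib cong: if_cong)
    have Avk: "(A *v v) $ k = ?s"
      by (simp add: matrix_vector_mult_def inner_vec_def)
    have "w \<bullet> (A *v w) = v \<bullet> (A *v v) - 2 * (?s / ?p) * ?s + (?s / ?p)\<^sup>2 * ?p"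
      unfolding w_def by (simp add: matrix_vector_mult_diff_distrib matrix_vector_mult_scaleR
          inner_diff_left inner_diff_right Ax Avk inner_axis' inner_axis inner_commute[of v]
          power2_eq_square algebra_simps)
    also have "\<dots> = v \<bullet> (A *v v) - (1 / ?p) * ?s\<^sup>2"
      using assms(2) by (simp add: power2_eq_square field_simps)
    also have "\<dots> = v \<bullet> (?B *v v)"
      by (simp add: matrix_vector_mult_diff_rdistrib inner_diff_right scaleR_matrix_vector_assoc[symmetric]
          quadratic_form_outer)
    finally show ?thesis using assms(1) by (metis psd_def)
  qed
  moreover have "transpose ?B = ?B"
    using sym by (simp add: transpose_def outer_def vec_eq_iff mult.commute)
  ultimately show ?thesis by (simp add: psd_def)
qed

text \<open>Pivots reduce \<open>B\<close> to zero, each splitting off a positive multiple of some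
  \<open>outer v\<close>, which pairs with \<open>A\<close> to a value of the quadratic form of
  \<open>A\<close>.\<close>

lemma psd_inner_nonneg:
  assumes "psd A" "psd B"
  shows "0 \<le> A \<bullet> B"
proof -
  \<comment> \<open>Induction on a finite set that contains all indices with nonzero diagonal entry;
    a pivot removes one index.\<close>
  have "0 \<le> A \<bullet> B" if "psd B" "{k. B $ k $ k \<noteq> 0} \<subseteq> K" for B K
    using finite[of K] that
  proof (induction K arbitrary: B rule: finite_induct)
    case empty
    have "(B $ a $ b)\<^sup>2 \<le> 0" for a b
      using psd_minor[OF empty(1), of a b] empty(2) by auto
    then have "B = 0" by (simp add: vec_eq_iff)
    then show ?case by simp
  next
    case (insert k K)
    show ?case
    proof (cases "B $ k $ k = 0")
      case True
      then show ?thesis using insert by blast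
    next
      case False
      then have pos: "0 < B $ k $ k"
        using psd_diag_nonneg[OF insert.prems(1), of k] by simp
      let ?B = "B - (1 / B $ k $ k) *\<^sub>R outer (B $ k)"
      \<comment> \<open>A zero diagonal entry forces a zero row, so the pivot creates no new nonzero
        diagonal entry.\<close>
      have "B $ k $ a = 0" if "a \<notin> insert k K" for a
        using psd_minor[OF insert.prems(1), of k a] insert.prems(2) that by force
      then have "?B $ a $ a = 0" if "a \<notin> K" for a
        using insert.prems(2) pos that by (cases "a = k") (auto simp: outer_def)
      then have "{a. ?B $ a $ a \<noteq> 0} \<subseteq> K" by blast
      then have "0 \<le> A \<bullet> ?B"
        using insert.IH psd_pivot[OF insert.prems(1) pos] by blast
      moreover have "0 \<le> A \<bullet> outer (B $ k)"
        using assms(1) by (simp add: inner_outer psd_def)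
      ultimately show ?thesis
        using pos by (simp add: inner_diff_right) (smt (verit) divide_nonneg_pos)
    qed
  qed
  then show ?thesis using assms(2) by blast
qed

text \<open>Averaging over \<open>t\<close> and \<open>- t\<close> on the line through
  \<open>v\<close> cancels the linear term, and a negative quadratic part would be unbounded
  below.\<close>

lemma quadratic_bounded_below_imp_nonneg:
  fixes A :: "real^'a^'a"
  assumes "\<And>x. r \<le> x \<bullet> (A *v x) + d \<bullet> x"
  shows "0 \<le> v \<bullet> (A *v v)"
proof (rule ccontr)
  assume "\<not> 0 \<le> v \<bullet> (A *v v)"
  then have neg: "v \<bullet> (A *v v) < 0" (is "?q < 0") by simp
  have *: "r \<le> t\<^sup>2 * ?q + t * (d \<bullet> v)" for t
    using assms[of "t *\<^sub>R v"]
    by (simp add: matrix_vector_mult_scaleR power2_eq_square mult_ac)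
  have **: "r \<le> t\<^sup>2 * ?q" for t
    using *[of t] *[of "- t"] by simp
  have "0 \<le> (\<bar>r\<bar> + 1) / - ?q" using neg by (intro divide_nonneg_pos) auto
  \<comment> \<open>The root is chosen so that \<open>t^2 * ?q\<close> equals
    \<open>- (\<bar>r\<bar> + 1)\<close>, which is below \<open>r\<close>.\<close>
  then have "r \<le> (\<bar>r\<bar> + 1) / - ?q * ?q"
    using **[of "sqrt ((\<bar>r\<bar> + 1) / - ?q)"] by (metis real_sqrt_pow2)
  also have "\<dots> = - (\<bar>r\<bar> + 1)" using neg by simp
  finally have "r \<le> - (\<bar>r\<bar> + 1)" .
  then show False by simp
qed

subsection \<open>Cones of moment matrices\<close>

definition moment :: "('a::finite \<Rightarrow> 'v::finite set) \<Rightarrow> real^('v set) \<Rightarrow> real^'a^'a" where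
  "moment e y = (\<chi> a b. y $ (e a \<union> e b))"

definition moment_adj :: "('a::finite \<Rightarrow> 'v::finite set) \<Rightarrow> real^'a^'a \<Rightarrow> real^('v set)" where
  "moment_adj e S = (\<Sum>a\<in>UNIV. \<Sum>b\<in>UNIV. S $ a $ b *\<^sub>R axis (e a \<union> e b) 1)"

lemma inner_moment_adj: "y \<bullet> moment_adj e S = S \<bullet> moment e y"
  by (simp add: moment_adj_def moment_def inner_matrix inner_sum_right inner_axis)

lemma moment_adj_add: "moment_adj e (S + T) = moment_adj e S + moment_adj e T"
  by (simp add: moment_adj_def scaleR_add_left sum.distrib)

lemma moment_adj_diff: "moment_adj e (S - T) = moment_adj e S - moment_adj e T"
  by (simp add: moment_adj_def scaleR_diff_left sum_subtractf)

lemma moment_adj_scaleR: "moment_adj e (r *\<^sub>R S) = r *\<^sub>R moment_adj e S"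
  by (simp add: moment_adj_def scaleR_sum_right)

lemma moment_adj_zero [simp]: "moment_adj e 0 = 0"
  by (simp add: moment_adj_def)

lemma transpose_moment: "transpose (moment e y) = moment e y"
  by (simp add: moment_def transpose_def vec_eq_iff Un_commute)

text \<open>The coefficients of the square of the polynomial \<open>\<Sum>A. u\<^sub>A x\<^sup>A\<close> on \<open>{0,1}\<close>-vectors, where \<open>x\<^sup>A\<close>
  is the product over \<open>A\<close>, so that \<open>x\<^sup>A x\<^sup>B = x\<^sup>A\<^sup>\<union>\<^sup>B\<close>.\<close>

definition msquare :: "real^('v::finite set) \<Rightarrow> real^('v set)" where
  "msquare u = moment_adj (\<lambda>A. A) (outer u)"

text \<open>The coefficient vector of the polynomial with the terms \<open>v $ a\<close> times the
  monomial of \<open>e a\<close>; coefficients of coinciding labels add up.\<close>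

definition push :: "('a::finite \<Rightarrow> 'v::finite set) \<Rightarrow> real^'a \<Rightarrow> real^('v set)" where
  "push e v = (\<Sum>a\<in>UNIV. v $ a *\<^sub>R axis (e a) 1)"

lemma inner_push: "y \<bullet> push e v = (\<Sum>a\<in>UNIV. v $ a * y $ e a)"
  by (simp add: push_def inner_sum_right inner_axis)

text \<open>Both sides hold the coefficients of the square of the polynomial
  \<open>push e v\<close>, reduced by idempotence of the variables.\<close>

lemma moment_adj_outer:
  fixes e :: "'a::finite \<Rightarrow> 'b::finite set"
  shows "moment_adj e (outer v) = msquare (push e v)"
proof (rule vector_eq_rdot[THEN iffD1], rule allI)
  fix y :: "real^('b set)"
  \<comment> \<open>\<open>w\<close> sums out one of the two factors, so that
    \<open>inner_push\<close> applies to each factor in turn.\<close>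
  define w where "w = (\<chi> A. \<Sum>b\<in>UNIV. v $ b * y $ (A \<union> e b))"
  have "y \<bullet> moment_adj e (outer v) = (\<Sum>a\<in>UNIV. v $ a * (\<Sum>b\<in>UNIV. v $ b * y $ (e a \<union> e b)))"
    by (simp add: inner_moment_adj inner_matrix outer_def moment_def sum_distrib_left mult_ac)
  also have "\<dots> = w \<bullet> push e v"
    by (simp add: inner_push w_def)
  also have "\<dots> = (\<Sum>A\<in>UNIV. push e v $ A * ((\<chi> B. y $ (A \<union> B)) \<bullet> push e v))"
    unfolding inner_push[of "\<chi> B. y $ (_ \<union> B)"] by (simp add: w_def inner_vec_def mult.commute)
  also have "\<dots> = y \<bullet> msquare (push e v)"
    unfolding msquare_def inner_moment_adj inner_matrix
    by (simp add: outer_def moment_def inner_vec_def sum_distrib_left mult_ac)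
  finally show "moment_adj e (outer v) \<bullet> y = msquare (push e v) \<bullet> y"
    by (simp add: inner_commute)
qed

lemma continuous_on_msquare: "continuous_on U msquare"
  unfolding msquare_def moment_adj_def outer_def by (simp, intro continuous_intros)

lemma msquare_scaleR: "msquare (r *\<^sub>R u) = r\<^sup>2 *\<^sub>R msquare u"
proof -
  have "outer (r *\<^sub>R u) = r\<^sup>2 *\<^sub>R outer u"
    by (simp add: outer_def vec_eq_iff power2_eq_square)
  then show ?thesis by (simp add: msquare_def moment_adj_scaleR)
qed

lemma msquare_zero [simp]: "msquare 0 = 0"
  using msquare_scaleR[of 0 0] by simp

text \<open>A set \<open>B\<close> stands for its indicator vector, so that pairing with \<open>point_count\<close> sums the values of
  a polynomial over all \<open>{0,1}\<close>-vectors.\<close>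

definition point_count :: "real^('v::finite set)" where
  "point_count = (\<chi> A. \<Sum>B\<in>UNIV. of_bool (A \<subseteq> B))"

text \<open>The condition \<open>A \<union> A' \<subseteq> B\<close> splits into one condition per
  factor, so each \<open>B\<close> contributes the squared value of the polynomial at its indicator
  vector.\<close>

lemma point_count_msquare:
  "point_count \<bullet> msquare u = (\<Sum>B\<in>UNIV. (\<Sum>A | A \<subseteq> B. u $ A)\<^sup>2)"
proof -
  have "point_count \<bullet> msquare u =
      (\<Sum>A\<in>UNIV. \<Sum>A'\<in>UNIV. \<Sum>B\<in>UNIV. u $ A * u $ A' * of_bool (A \<union> A' \<subseteq> B))"
    by (simp add: msquare_def inner_moment_adj inner_matrix outer_def moment_def point_count_def
        sum_distrib_left mult_ac del: sum_of_bool_eq)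
  also have "\<dots> = (\<Sum>B\<in>UNIV. \<Sum>A\<in>UNIV. \<Sum>A'\<in>UNIV. u $ A * u $ A' * of_bool (A \<union> A' \<subseteq> B))"
    by (rule trans[OF sum.cong[OF refl sum.swap] sum.swap])
  also have "\<dots> = (\<Sum>B\<in>UNIV. (\<Sum>A\<in>UNIV. u $ A * of_bool (A \<subseteq> B))\<^sup>2)"
    by (simp only: power2_eq_square sum_product of_bool_conj Un_subset_iff mult_ac)
  also have "\<dots> = (\<Sum>B\<in>UNIV. (\<Sum>A | A \<subseteq> B. u $ A)\<^sup>2)"
    by (simp add: of_bool_def if_distrib sum.If_cases cong: if_cong)
  finally show ?thesis .
qed

lemma point_count_msquare_pos:
  assumes "u \<noteq> 0"
  shows "0 < point_count \<bullet> msquare u"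
proof (rule ccontr)
  assume "\<not> ?thesis"
  then have "(\<Sum>B\<in>UNIV. (\<Sum>A | A \<subseteq> B. u $ A)\<^sup>2) = 0"
    by (metis point_count_msquare not_less order_antisym sum_nonneg zero_le_power2)
  then have z: "(\<Sum>A | A \<subseteq> B. u $ A) = 0" for B
    by (simp add: sum_nonneg_eq_0_iff)
  \<comment> \<open>The values determine the coefficients by a triangular system ordered by
    inclusion.\<close>
  have "u $ B = 0" for B
  proof (induction B rule: measure_induct_rule[of card])
    case (less B)
    have "{A. A \<subseteq> B} = insert B {A. A \<subset> B}" by auto
    then have "u $ B + (\<Sum>A | A \<subset> B. u $ A) = 0" using z[of B] by simp
    moreover have "(\<Sum>A | A \<subset> B. u $ A) = 0"
      by (intro sum.neutral ballI less.IH psubset_card_mono) auto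
    ultimately show ?case by simp
  qed
  then have "u = 0" by (simp add: vec_eq_iff)
  with assms show False ..
qed

text \<open>The image of the positive semidefinite cone has a compact base not containing 0: the squares
  of normalized polynomials sum to a positive value over \<open>{0,1}\<close>-points. Hence it is closed, which
  yields the multiplier matrix without any constraint qualification on \<^term>\<open>e\<close>.\<close>

lemma moment_adj_separation:
  fixes e :: "'a::finite \<Rightarrow> 'v::finite set" and z :: "real^('v set)"
  assumes "\<And>y. psd (moment e y) \<Longrightarrow> 0 \<le> y \<bullet> z"
  shows "\<exists>S. psd S \<and> moment_adj e S = z"
proof -
  define T where "T = msquare ` (range (push e) \<inter> sphere 0 1)"
  define K where "K = convex_cone hull T"
  have "closed (range (push e))"
  proof -
    have "linear (push e)"
      by (rule linearI) (simp_all add: push_def scaleR_add_left sum.distrib scaleR_sum_right)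
    then show ?thesis by (intro closed_subspace linear_subspace_image) auto
  qed
  then have "compact T"
    unfolding T_def by (intro compact_continuous_image continuous_on_msquare)
      (simp add: compact_Int_closed Int_commute)
  then have "compact (convex hull T)" by (rule compact_convex_hull)
  moreover have "convex hull T \<subseteq> {w. point_count \<bullet> w > 0}"
    by (rule hull_minimal) (auto simp: T_def convex_halfspace_gt intro!: point_count_msquare_pos)
  then have "0 \<notin> convex hull T" by auto
  \<comment> \<open>\<open>K\<close> is 0 together with the conic hull of a compact convex set
    avoiding 0, and such a hull is closed.\<close>
  ultimately have "closed K"
    unfolding K_def convex_cone_hull_separate by (intro closed_insert closed_conic_hull) auto
  moreover have "convex K" by (simp add: K_def convex_convex_cone_hull)
  moreover have T_in: "msquare (push e v) \<in> K" for v
  proof (cases "push e v = 0")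
    case True
    then show ?thesis by (simp add: K_def convex_cone_hull_contains_0)
  next
    case False
    let ?n = "norm (push e v)"
    have "(1 / ?n) *\<^sub>R push e v = push e ((1 / ?n) *\<^sub>R v)"
      by (simp add: push_def scaleR_sum_right)
    then have "(1 / ?n) *\<^sub>R push e v \<in> range (push e)" by (rule range_eqI)
    then have "msquare ((1 / ?n) *\<^sub>R push e v) \<in> T"
      unfolding T_def using False by (intro imageI) simp
    then have "?n\<^sup>2 *\<^sub>R msquare ((1 / ?n) *\<^sub>R push e v) \<in> K"
      unfolding K_def by (intro convex_cone_hull_mul hull_inc) auto
    then show ?thesis using False by (simp add: msquare_scaleR power_divide)
  qed
  have "z \<in> K"
  proof (rule ccontr)
    assume "z \<notin> K"
    then obtain y b where yb: "y \<bullet> z < b" "\<And>w. w \<in> K \<Longrightarrow> b < y \<bullet> w"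
      using separating_hyperplane_closed_point[OF \<open>convex K\<close> \<open>closed K\<close>] by blast
    have "b < 0" using yb(2)[of 0] by (simp add: K_def convex_cone_hull_contains_0)
    have "0 \<le> y \<bullet> w" if "w \<in> K" for w
    proof (rule ccontr)
      assume n: "\<not> 0 \<le> y \<bullet> w"
      \<comment> \<open>Rescaling \<open>w\<close> by this positive factor would give exactly the
        value \<open>b\<close>, against strict separation.\<close>
      then have "(b / (y \<bullet> w)) *\<^sub>R w \<in> K"
        using that \<open>b < 0\<close> unfolding K_def by (intro convex_cone_hull_mul) (auto simp: divide_nonpos_neg)
      from yb(2)[OF this] n show False by simp
    qed
    then have "0 \<le> y \<bullet> moment_adj e (outer v)" for v
      using T_in by (simp add: moment_adj_outer)
    then have "psd (moment e y)"
      by (simp add: inner_moment_adj psd_def transpose_moment inner_commute[of "outer _"] inner_outer)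
    then show False using assms[of y] yb(1) \<open>b < 0\<close> by simp
  qed
  moreover have "K \<subseteq> {moment_adj e S |S. psd S}"
    unfolding K_def
  proof (rule hull_minimal)
    show "T \<subseteq> {moment_adj e S |S. psd S}"
      unfolding T_def by (auto simp flip: moment_adj_outer) (metis psd_outer)
    show "convex_cone {moment_adj e S |S. psd S}"
      unfolding convex_cone_iff
    proof (intro conjI ballI allI impI)
      show "0 \<in> {moment_adj e S |S. psd S}" using psd_zero by force
      show "x + y \<in> {moment_adj e S |S. psd S}"
        if "x \<in> {moment_adj e S |S. psd S}" "y \<in> {moment_adj e S |S. psd S}" for x y
        using that by clarsimp (metis moment_adj_add psd_add)
      show "r *\<^sub>R x \<in> {moment_adj e S |S. psd S}"
        if "x \<in> {moment_adj e S |S. psd S}" "0 \<le> r" for x r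
        using that by clarsimp (metis moment_adj_scaleR psd_scaleR)
    qed
  qed
  ultimately show ?thesis by blast
qed

subsection \<open>The Lagrangian and the feasible set\<close>

lemma sum_UNIV_option: "(\<Sum>a\<in>UNIV. f a) = f None + (\<Sum>i\<in>UNIV. f (Some i))"
  for f :: "'a::finite option \<Rightarrow> 'b::comm_monoid_add"
  by (simp add: UNIV_option_conv sum.reindex)

lemma bordered_nth [simp]:
  "bordered x X $ None $ None = 1"
  "bordered x X $ None $ Some j = x $ j"
  "bordered x X $ Some i $ None = x $ i"
  "bordered x X $ Some i $ Some j = X $ i $ j"
  by (simp_all add: bordered_def)

definition homogenize :: "real^'v \<Rightarrow> real^('v::finite option)" where
  "homogenize x = (\<chi> a. case a of None \<Rightarrow> 1 | Some i \<Rightarrow> x $ i)"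

lemma bordered_outer: "bordered x (outer x) = outer (homogenize x)"
  by (simp add: vec_eq_iff bordered_def outer_def homogenize_def split: option.splits)

lemma psd_bordered_schur:
  assumes "psd (bordered x X)"
  shows "psd (X - outer x)"
proof -
  have sym: "X $ i $ j = X $ j $ i" for i j
    using psd_entry_sym[OF assms, of "Some i" "Some j"] by simp
  have "0 \<le> v \<bullet> ((X - outer x) *v v)" for v
  proof -
    \<comment> \<open>For fixed \<open>v\<close> the border entry \<open>- (x \<bullet> v)\<close>
      minimizes the bordered form; the minimum is the form of the Schur complement.\<close>
    define w where "w = (\<chi> a. case a of None \<Rightarrow> - (x \<bullet> v) | Some i \<Rightarrow> v $ i)"
    have "w \<bullet> (bordered x X *v w) = (x \<bullet> v)\<^sup>2 - (x \<bullet> v) * (\<Sum>i\<in>UNIV. x $ i * v $ i)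
        - (x \<bullet> v) * (\<Sum>i\<in>UNIV. x $ i * v $ i) + v \<bullet> (X *v v)"
      by (simp add: quadratic_form_sum sum_UNIV_option w_def power2_eq_square sum.distrib
          sum_distrib_left sum_negf sum_subtractf mult_ac)
    also have "\<dots> = v \<bullet> ((X - outer x) *v v)"
      by (simp add: matrix_vector_mult_diff_rdistrib inner_diff_right quadratic_form_outer
          power2_eq_square) (simp add: inner_vec_def)
    finally show ?thesis using assms by (metis psd_def)
  qed
  then show ?thesis
    using sym by (simp add: psd_def transpose_def vec_eq_iff outer_def mult.commute)
qed

lemma inner_sym_unit_matrix:
  assumes "transpose X = X"
  shows "sym_unit i j \<bullet> X = X $ i $ j"
proof -
  have entry: "(\<Sum>a\<in>UNIV. \<Sum>b\<in>UNIV. of_bool (a = p \<and> b = q) * X $ a $ b) = X $ p $ q" for p q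
  proof -
    have "(\<Sum>b\<in>UNIV. of_bool (a = p \<and> b = q) * X $ a $ b) = (if a = p then X $ a $ q else 0)" for a
      by (simp add: of_bool_conj of_bool_def if_distrib [where f="\<lambda>z. z * _"] cong: if_cong)
    then show ?thesis by simp
  qed
  have "X $ j $ i = X $ i $ j"
    using assms by (rule transpose_eq_entry)
  then show ?thesis
    by (simp only: inner_matrix sym_unit_def vec_lambda_beta add_divide_distrib distrib_right
        times_divide_eq_left sum.distrib entry field_sum_of_halves flip: sum_divide_distrib)
qed

text \<open>At a rank-one point every constraint of (SDP) becomes the quadratic expression that
  carries the same multiplier in \<open>g_par\<close>.\<close>

lemma SDP_lagrangian_outer:
  "SDP_lagrangian I E Q c \<alpha> \<beta> \<delta> lam S x (outer x) =
     g_par I E Q c \<alpha> \<beta> \<delta> lam x - homogenize x \<bullet> (S *v homogenize x)"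
  unfolding SDP_lagrangian_def g_par_def SDP_obj_def g_obj_def bordered_outer inner_outer
  by (simp add: outer_def power2_eq_square algebra_simps)

text \<open>One \<open>d\<close> serves all pairs, so that the values at \<open>outer x\<close> and
  at a feasible \<open>X\<close> can be compared.\<close>

lemma SDP_lagrangian_affine:
  "\<exists>d. \<forall>x X. transpose X = X \<longrightarrow>
     SDP_lagrangian I E Q c \<alpha> \<beta> \<delta> lam 0 x X = Q_par I E Q \<alpha> \<beta> \<delta> lam \<bullet> X + d \<bullet> x"
proof -
  define d where "d = c - (\<Sum>i\<in>UNIV. \<alpha> i *\<^sub>R axis i 1)
     + (\<Sum>(i, j)\<in>Jbeta I E. \<beta> i j *\<^sub>R axis i 1)
     + (\<Sum>(i, j, k)\<in>Jdelta I E. \<delta> i j k *\<^sub>R axis i 1)"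
  have "SDP_lagrangian I E Q c \<alpha> \<beta> \<delta> lam 0 x X = Q_par I E Q \<alpha> \<beta> \<delta> lam \<bullet> X + d \<bullet> x"
    if "transpose X = X" for x X
    by (simp add: SDP_lagrangian_def SDP_obj_def Q_par_def d_def inner_add_left inner_diff_left
        inner_sum_left case_prod_unfold inner_sym_unit_matrix[OF that] inner_axis'
        right_diff_distrib distrib_left sum.distrib sum_subtractf sum_negf)
  then show ?thesis by blast
qed

text \<open>The bound has to hold on the whole space: on a box every quadratic function is bounded
  below.\<close>

lemma psd_Q_par:
  assumes "transpose Q = Q" and "\<And>x. r \<le> g_par I E Q c \<alpha> \<beta> \<delta> lam x"
  shows "psd (Q_par I E Q \<alpha> \<beta> \<delta> lam)"
proof -
  obtain d where "g_par I E Q c \<alpha> \<beta> \<delta> lam x = x \<bullet> (Q_par I E Q \<alpha> \<beta> \<delta> lam *v x) + d \<bullet> x" for x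
    using g_par_quadratic_form by metis
  then show ?thesis
    using assms(2) quadratic_bounded_below_imp_nonneg[of r "Q_par I E Q \<alpha> \<beta> \<delta> lam" d]
    by (simp add: psd_def transpose_Q_par[OF assms(1)])
qed

lemma SDP_lagrangian_feasible:
  assumes "SDP_feasible I E x X"
  shows "SDP_lagrangian I E Q c \<alpha> \<beta> \<delta> lam S x X = SDP_obj Q c x X - S \<bullet> bordered x X"
proof -
  have "(\<Sum>i\<in>UNIV. \<alpha> i * (X $ i $ i - x $ i)) = 0"
    "(\<Sum>(i, j)\<in>Jbeta I E. \<beta> i j * (- X $ i $ j + x $ i)) = 0"
    "(\<Sum>(i, j, k)\<in>Jdelta I E. \<delta> i j k * (- X $ j $ k + x $ i)) = 0"
    "(\<Sum>(i, j, k, l)\<in>Jlambda E. lam i j k l * (X $ i $ j - X $ k $ l)) = 0"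
    using assms unfolding SDP_feasible_def by (auto intro!: sum.neutral)
  then show ?thesis unfolding SDP_lagrangian_def by linarith
qed

lemma g_par_le_SDP_obj:
  assumes "SDP_feasible I E x X" and "psd (Q_par I E Q \<alpha> \<beta> \<delta> lam)"
  shows "g_par I E Q c \<alpha> \<beta> \<delta> lam x \<le> SDP_obj Q c x X"
proof -
  let ?P = "Q_par I E Q \<alpha> \<beta> \<delta> lam"
  obtain d where d: "transpose Y = Y \<Longrightarrow>
      SDP_lagrangian I E Q c \<alpha> \<beta> \<delta> lam 0 z Y = ?P \<bullet> Y + d \<bullet> z" for z Y
    using SDP_lagrangian_affine[of I E Q c \<alpha> \<beta> \<delta> lam] by blast
  have "psd (X - outer x)"
    using assms(1) by (auto simp: SDP_feasible_def intro: psd_bordered_schur)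
  then have "0 \<le> ?P \<bullet> (X - outer x)" by (rule psd_inner_nonneg[OF assms(2)])
  moreover have "g_par I E Q c \<alpha> \<beta> \<delta> lam x = ?P \<bullet> outer x + d \<bullet> x"
    using d[of "outer x" x] psd_outer[of x] by (simp add: SDP_lagrangian_outer psd_def)
  moreover have "SDP_obj Q c x X = ?P \<bullet> X + d \<bullet> x"
    using d[of X x] assms(1) SDP_lagrangian_feasible[OF assms(1), of Q c \<alpha> \<beta> \<delta> lam 0]
    by (simp add: SDP_feasible_def)
  ultimately show ?thesis by (simp add: inner_diff_right)
qed

section \<open>Fortet inequalities, compactness and attainment of the primal minimum\<close>

lemma SDP_feasible_diag:
  assumes "SDP_feasible I E x X"
  shows "X $ i $ i = x $ i"
  using assms by (simp add: SDP_feasible_def)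

lemma SDP_feasible_box:
  assumes "SDP_feasible I E x X"
  shows "0 \<le> x $ i" and "x $ i \<le> 1" and "\<bar>X $ i $ j\<bar> \<le> 1"
proof -
  have B: "psd (bordered x X)" using assms by (simp add: SDP_feasible_def)
  note D = SDP_feasible_diag[OF assms]
  show pos: "0 \<le> x $ i" for i using psd_diag_nonneg[OF B, of "Some i"] by (simp add: D)
  show le1: "x $ i \<le> 1" for i
    \<comment> \<open>The form at this vector is \<open>1 - 2 * x $ i + X $ i $ i\<close>, that is
      \<open>1 - x $ i\<close>.\<close>
    using psd_principal_2[OF B, of 1 None "-1" "Some i"] by (simp add: D)
  have "(X $ i $ j)\<^sup>2 \<le> x $ i * x $ j"
    using psd_minor[OF B, of "Some i" "Some j"] by (simp add: D)
  also have "\<dots> \<le> 1" using pos le1 by (simp add: mult_le_one)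
  finally show "\<bar>X $ i $ j\<bar> \<le> 1" by (simp add: abs_square_le_1)
qed

lemma SDP_feasible_F_relax:
  assumes "SDP_feasible I E x X"
  shows "x \<in> F_relax I E"
proof -
  have B: "psd (bordered x X)" using assms by (simp add: SDP_feasible_def)
  note D = SDP_feasible_diag[OF assms]
  have J: "\<forall>(i, j, k, l)\<in>Jlambda E. X $ i $ j - X $ k $ l = 0"
    using assms unfolding SDP_feasible_def by (elim conjE)
  have L: "X $ i $ j = X $ k $ l" if "E i \<union> E j = E k \<union> E l" for i j k l
    using bspec[OF J, of "(i, j, k, l)"] that by (simp add: Jlambda_def)
  have "x $ i \<le> x $ i1 \<and> x $ i \<le> x $ i2 \<and> x $ i \<ge> x $ i1 + x $ i2 - 1"
    if "E i = E i1 \<union> E i2" for i i1 i2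
  proof -
    \<comment> \<open>\<open>E i1\<close> and \<open>E i2\<close> lie in \<open>E i\<close>, so all
      these label unions equal \<open>E i \<union> E i\<close>, and (iv) and (i) apply.\<close>
    have X: "X $ i $ i1 = x $ i" "X $ i1 $ i = x $ i" "X $ i $ i2 = x $ i" "X $ i2 $ i = x $ i"
      "X $ i1 $ i2 = x $ i" "X $ i2 $ i1 = x $ i"
      using that L[of i i1 i i] L[of i1 i i i] L[of i i2 i i] L[of i2 i i i]
        L[of i1 i2 i i] L[of i2 i1 i i]
      by (simp_all add: D Un_absorb1 Un_absorb2 Un_commute Un_left_commute)
    \<comment> \<open>The vector encodes \<open>(1 - x $ i1) * (1 - x $ i2)\<close>, which is
      idempotent on binary points; accordingly its form reduces to
      \<open>1 - x $ i1 - x $ i2 + x $ i\<close>.\<close>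
    let ?v = "axis None 1 - axis (Some i1) 1 - axis (Some i2) 1 + axis (Some i) 1 :: real^'a option"
    have "0 \<le> ?v \<bullet> (bordered x X *v ?v)" using B unfolding psd_def by blast
    then have "x $ i \<ge> x $ i1 + x $ i2 - 1"
      by (simp add: matrix_vector_right_distrib matrix_vector_mult_diff_distrib inner_add_left
          inner_add_right inner_diff_left inner_diff_right axis_quadratic_form X D)
    moreover have "x $ i \<le> x $ i1" "x $ i \<le> x $ i2"
      using psd_principal_2[OF B, of 1 "Some i" "-1" "Some i1"]
        psd_principal_2[OF B, of 1 "Some i" "-1" "Some i2"] by (simp_all add: X D)
    ultimately show ?thesis by blast
  qed
  then show ?thesis
    using SDP_feasible_box[OF assms] by (auto simp: F_relax_def fortet_def Jdelta_def)
qed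

lemma SDP_feasible_0: "SDP_feasible I E (0 :: real^'a::finite) 0"
proof -
  have "bordered (0 :: real^'a) 0 = outer (homogenize 0)"
    by (simp flip: bordered_outer) (simp add: outer_def zero_vec_def)
  then have "psd (bordered (0 :: real^'a) 0)" by (metis psd_outer)
  then show ?thesis
    by (simp add: SDP_feasible_def transpose_def vec_eq_iff case_prod_unfold)
qed

lemma compact_SDP_feasible: "compact {(x :: real^'a::finite, X). SDP_feasible I E x X}"
proof -
  let ?F = "{(x :: real^'a, X). SDP_feasible I E x X}"
  have cont: "continuous_on UNIV (\<lambda>p. bordered (fst p :: real^'a) (snd p) $ a $ b)" for a b
    by (cases a; cases b) (auto intro!: continuous_intros)
  have "closed {p. SDP_feasible I E (fst p) (snd p)}"
    unfolding SDP_feasible_def psd_def Ball_def quadratic_form_sum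
      vec_eq_iff transpose_def vec_lambda_beta case_prod_unfold
    by (intro closed_Collect_conj closed_Collect_all closed_Collect_imp closed_Collect_le
        closed_Collect_eq open_Collect_const) (auto intro!: cont continuous_intros)
  then have "closed ?F" by (simp add: case_prod_unfold)
  moreover have "bounded ?F"
  proof -
    have "norm x \<le> CARD('a)" if "SDP_feasible I E x X" for x X
    proof -
      have "norm x \<le> (\<Sum>i\<in>UNIV. \<bar>x $ i\<bar>)" by (rule norm_le_l1_cart)
      also have "\<dots> \<le> (\<Sum>i\<in>(UNIV :: 'a set). 1)"
        using SDP_feasible_box(1,2)[OF that] by (intro sum_mono) simp
      finally show ?thesis by simp
    qed
    moreover have "norm X \<le> real (CARD('a) * CARD('a))" if "SDP_feasible I E x X" for x X
    proof -
      have "norm X \<le> (\<Sum>i\<in>UNIV. norm (X $ i))" by (simp add: norm_vec_def L2_set_le_sum)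
      also have "\<dots> \<le> (\<Sum>i\<in>UNIV. \<Sum>j\<in>UNIV. \<bar>X $ i $ j\<bar>)" by (intro sum_mono norm_le_l1_cart)
      also have "\<dots> \<le> (\<Sum>i\<in>(UNIV :: 'a set). \<Sum>j\<in>(UNIV :: 'a set). 1)"
        using SDP_feasible_box[OF that] by (intro sum_mono)
      finally show ?thesis by simp
    qed
    ultimately have "?F \<subseteq> cball 0 CARD('a) \<times> cball 0 (CARD('a) * CARD('a))" by auto
    then show ?thesis by (rule bounded_subset[OF bounded_Times[OF bounded_cball bounded_cball]])
  qed
  ultimately show ?thesis by (simp add: compact_eq_bounded_closed)
qed

lemma SDP_optimal_exists: "\<exists>x X. SDP_optimal I E Q c x X"
proof -
  let ?F = "{(x, X). SDP_feasible I E x X}"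
  have "\<exists>p\<in>?F. \<forall>q\<in>?F. SDP_obj Q c (fst p) (snd p) \<le> SDP_obj Q c (fst q) (snd q)"
  proof (rule continuous_attains_inf[OF compact_SDP_feasible])
    show "?F \<noteq> {}" using SDP_feasible_0 by blast
    show "continuous_on ?F (\<lambda>p. SDP_obj Q c (fst p) (snd p))"
      unfolding SDP_obj_def by (intro continuous_intros)
  qed
  then obtain x X where F: "SDP_feasible I E x X"
    and min: "\<And>y Y. SDP_feasible I E y Y \<Longrightarrow> SDP_obj Q c x X \<le> SDP_obj Q c y Y" by auto
  have "ereal (SDP_obj Q c x X) = SDP_value I E Q c"
    unfolding SDP_value_def using F min by (intro antisym INF_greatest INF_lower2[of "(x, X)"]) auto
  with F show ?thesis unfolding SDP_optimal_def by blast
qed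

subsection \<open>Strong duality\<close>

definition opt_label :: "('v::finite \<Rightarrow> 'v set) \<Rightarrow> 'v option \<Rightarrow> 'v set" where
  "opt_label E = case_option {} E"

lemma opt_label_simps [simp]: "opt_label E None = {}" "opt_label E (Some i) = E i"
  by (simp_all add: opt_label_def)

text \<open>This keeps the labels of variables apart from the label \<open>{}\<close> of the
  border.\<close>

lemma quadratization_nonempty:
  assumes "quadratization I fac E"
  shows "E i \<noteq> {}"
proof -
  have "wf {(k, i). i \<in> - I \<and> (k = fst (fac i) \<or> k = snd (fac i))}"
    using assms by (simp add: quadratization_def)
  then show ?thesis
  proof (induction i rule: wf_induct_rule)
    case (less i)
    show ?case
    proof (cases "i \<in> I")
      case True
      then show ?thesis using assms by (simp add: quadratization_def)
    next
      case False
      then have "E (fst (fac i)) \<noteq> {}" using less by simp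
      then show ?thesis using assms False by (simp add: quadratization_def)
    qed
  qed
qed

text \<open>Each of the equations (i) to (iv) equates entries of the bordered matrix with equal
  label unions.\<close>

lemma SDP_feasible_of_moment:
  fixes E :: "'v::finite \<Rightarrow> 'v set"
  assumes "psd (moment (opt_label E) y)" and "y $ {} = 1"
  defines "x \<equiv> \<chi> i. y $ E i" and "X \<equiv> \<chi> i j. y $ (E i \<union> E j)"
  shows "bordered x X = moment (opt_label E) y" and "SDP_feasible I E x X"
proof -
  show eq: "bordered x X = moment (opt_label E) y"
    using assms(2) by (simp add: vec_eq_iff bordered_def moment_def x_def X_def split: option.splits)
  have "transpose X = X" by (simp add: X_def transpose_def vec_eq_iff Un_commute)
  then show "SDP_feasible I E x X"
    unfolding SDP_feasible_def eq
    using assms(1) by (auto simp: x_def X_def Jbeta_def Jdelta_def Jlambda_def Un_absorb2)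
qed

text \<open>These multipliers live on the graph that sends each pair \<open>(i, j)\<close> to the
  representative of its union, hence one term per pair remains.\<close>

lemma sum_Jlambda_graph:
  fixes r :: "'v::finite set \<Rightarrow> 'v \<times> 'v" and W :: "real^'v^'v"
  assumes r: "\<And>i j. E (fst (r (E i \<union> E j))) \<union> E (snd (r (E i \<union> E j))) = E i \<union> E j"
  shows "(\<Sum>(i, j, k, l)\<in>Jlambda E. (if (k, l) = r (E i \<union> E j) then W $ i $ j else 0) * F i j k l)
    = (\<Sum>i\<in>UNIV. \<Sum>j\<in>UNIV. W $ i $ j * F i j (fst (r (E i \<union> E j))) (snd (r (E i \<union> E j))))"
proof -
  let ?h = "\<lambda>(i, j). (i, j, r (E i \<union> E j))"
  have r': "E k \<union> E l = E i \<union> E j" if "(k, l) = r (E i \<union> E j)" for i j k l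
    using r[of i j] that by (metis fst_conv snd_conv)
  have sub: "range ?h \<subseteq> Jlambda E" by (auto simp: Jlambda_def dest!: r')
  have "(\<Sum>(i, j, k, l)\<in>Jlambda E. (if (k, l) = r (E i \<union> E j) then W $ i $ j else 0) * F i j k l)
    = (\<Sum>(i, j, k, l)\<in>range ?h. (if (k, l) = r (E i \<union> E j) then W $ i $ j else 0) * F i j k l)"
    by (rule sum.mono_neutral_right[OF finite sub]) (auto simp: image_iff)
  also have "\<dots> = (\<Sum>(i, j)\<in>UNIV. W $ i $ j * F i j (fst (r (E i \<union> E j))) (snd (r (E i \<union> E j))))"
    by (subst sum.reindex) (auto simp: inj_on_def case_prod_unfold intro!: sum.cong)
  also have "\<dots> = (\<Sum>i\<in>UNIV. \<Sum>j\<in>UNIV. W $ i $ j * F i j (fst (r (E i \<union> E j))) (snd (r (E i \<union> E j))))"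
    by (simp add: sum.cartesian_product)
  finally show ?thesis .
qed

text \<open>A symmetric matrix that pairs to zero with all moment matrices lies in the span of the
  constraints (i) and (iv): move the weight of each entry to a representative of its label.\<close>

lemma annihilator_multipliers:
  fixes E :: "'v::finite \<Rightarrow> 'v set" and D :: "real^('v option)^('v option)"
  assumes D: "moment_adj (opt_label E) D = 0" "transpose D = D" and E: "\<And>i. E i \<noteq> {}"
  shows "\<exists>\<alpha> lam. \<forall>x X. D \<bullet> bordered x X + (\<Sum>i\<in>UNIV. \<alpha> i * (X $ i $ i - x $ i))
      + (\<Sum>(i, j, k, l)\<in>Jlambda E. lam i j k l * (X $ i $ j - X $ k $ l)) = 0"
proof -
  \<comment> \<open>\<open>d i\<close> is the total weight of \<open>x $ i\<close> in the pairing
    with \<open>D\<close>, from two symmetric border entries. Constraint (i) moves it to the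
    diagonal, after which \<open>X $ i $ j\<close> has weight \<open>- W $ i $ j\<close>.\<close>
  define d where "d i = 2 * D $ Some i $ None" for i
  define W where "W = (\<chi> i j. - (D $ Some i $ Some j + (if i = j then d i else 0)))"
  define r where "r A = (SOME p. E (fst p) \<union> E (snd p) = A)" for A
  have r: "E (fst (r (E i \<union> E j))) \<union> E (snd (r (E i \<union> E j))) = E i \<union> E j" for i j
    unfolding r_def by (rule someI_ex) (metis fst_conv snd_conv)
  have sym: "D $ None $ Some i = D $ Some i $ None" for i
    using D(2) by (rule transpose_eq_entry)
  have ann: "D \<bullet> moment (opt_label E) y = 0" for y
    by (metis D(1) inner_moment_adj inner_zero_right)
  have exp: "D \<bullet> B = D $ None $ None * B $ None $ None
      + (\<Sum>i\<in>UNIV. D $ Some i $ None * (B $ None $ Some i + B $ Some i $ None))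
      + (\<Sum>i\<in>UNIV. \<Sum>j\<in>UNIV. D $ Some i $ Some j * B $ Some i $ Some j)" for B
    by (simp add: inner_matrix sum_UNIV_option sym sum.distrib distrib_left)
  have D0: "D $ None $ None = 0"
    \<comment> \<open>By nonemptiness of the labels, only the corner entry has label union
      \<open>{}\<close>.\<close>
    using ann[of "\<chi> A. of_bool (A = {})"] by (simp add: exp moment_def E)
  have "D \<bullet> bordered x X + (\<Sum>i\<in>UNIV. d i * (X $ i $ i - x $ i))
      + (\<Sum>(i, j, k, l)\<in>Jlambda E.
          (if (k, l) = r (E i \<union> E j) then W $ i $ j else 0) * (X $ i $ j - X $ k $ l)) = 0" for x X
  proof -
    define h where "h A = X $ fst (r A) $ snd (r A)" for A
    have diag: "(\<Sum>j\<in>UNIV. (if i = j then d i else 0) * F j) = d i * F i" for i F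
      by (simp add: if_distrib[where f="\<lambda>z. z * _"] cong: if_cong)
    have "(\<Sum>i\<in>UNIV. d i * h (E i)) + (\<Sum>i\<in>UNIV. \<Sum>j\<in>UNIV. D $ Some i $ Some j * h (E i \<union> E j)) = 0"
      \<comment> \<open>The representative entries of an arbitrary \<open>X\<close> form a moment
        vector, which \<open>D\<close> annihilates; \<open>D0\<close> removes the arbitrary value
        \<open>h {}\<close>.\<close>
      using ann[of "\<chi> A. h A"] by (simp add: exp moment_def D0 d_def mult_ac)
    moreover have "(\<Sum>i\<in>UNIV. \<Sum>j\<in>UNIV. W $ i $ j * (X $ i $ j - h (E i \<union> E j))) =
        - ((\<Sum>i\<in>UNIV. \<Sum>j\<in>UNIV. D $ Some i $ Some j * X $ i $ j) + (\<Sum>i\<in>UNIV. d i * X $ i $ i))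
        + ((\<Sum>i\<in>UNIV. d i * h (E i)) + (\<Sum>i\<in>UNIV. \<Sum>j\<in>UNIV. D $ Some i $ Some j * h (E i \<union> E j)))"
      by (simp add: W_def right_diff_distrib left_diff_distrib sum.distrib sum_subtractf
          sum_negf diag)
    moreover have "D \<bullet> bordered x X = (\<Sum>i\<in>UNIV. d i * x $ i)
        + (\<Sum>i\<in>UNIV. \<Sum>j\<in>UNIV. D $ Some i $ Some j * X $ i $ j)"
      by (simp add: exp D0 d_def mult_ac)
    ultimately show ?thesis
      unfolding sum_Jlambda_graph[OF r] h_def by (simp add: right_diff_distrib sum_subtractf)
  qed
  then show ?thesis
    by (intro exI[of _ d] exI[of _ "\<lambda>i j k l. if (k, l) = r (E i \<union> E j) then W $ i $ j else 0"]) blast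
qed

text \<open>Halves appear because each linear coefficient occurs in two border entries.\<close>

definition cost_matrix :: "real^'v^'v \<Rightarrow> real^'v \<Rightarrow> real^('v::finite option)^('v option)" where
  "cost_matrix Q c = (\<chi> a b. case (a, b) of
       (None, None) \<Rightarrow> 0
     | (None, Some j) \<Rightarrow> c $ j / 2
     | (Some i, None) \<Rightarrow> c $ i / 2
     | (Some i, Some j) \<Rightarrow> Q $ i $ j)"

lemma inner_cost_matrix: "cost_matrix Q c \<bullet> bordered x X = SDP_obj Q c x X"
  by (simp add: inner_matrix sum_UNIV_option cost_matrix_def SDP_obj_def sum.distrib
      inner_vec_def flip: sum_divide_distrib)

text \<open>The multipliers make the Lagrangian constant, so the dual infimum is exactly
  \<open>p\<close>.\<close>

lemma SDP_strong_duality: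
  fixes E :: "'v::finite \<Rightarrow> 'v set"
  assumes E: "\<And>i. E i \<noteq> {}" and Q: "transpose Q = Q"
    and p: "\<And>x X. SDP_feasible I E x X \<Longrightarrow> p \<le> SDP_obj Q c x X"
  shows "\<exists>\<alpha> \<beta> \<delta> lam S. psd S \<and> (\<forall>x X. SDP_lagrangian I E Q c \<alpha> \<beta> \<delta> lam S x X = p)"
proof -
  let ?e = "opt_label E"
  \<comment> \<open>The homogenized objective minus \<open>p\<close>: nonnegative on all positive
    semidefinite moment matrices, not only on those with corner entry 1.\<close>
  define C where "C = cost_matrix Q c - p *\<^sub>R outer (axis None 1)"
  have C: "C \<bullet> B = cost_matrix Q c \<bullet> B - p * B $ None $ None" for B
    by (simp add: C_def inner_diff_left inner_commute[of "outer _"] inner_outer axis_quadratic_form)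
  have "0 \<le> y \<bullet> moment_adj ?e C" if y: "psd (moment ?e y)" for y
  proof (cases "y $ {} = 0")
    \<comment> \<open>A zero corner forces the border row to vanish; its entries are also the
      diagonal, so the whole moment matrix vanishes.\<close>
    case True
    have "moment ?e y $ None $ None = 0" using True by (simp add: moment_def)
    then have "(moment ?e y $ None $ b)\<^sup>2 \<le> 0" for b
      using psd_minor[OF y, of None b] by simp
    then have "moment ?e y $ None $ Some i = 0" for i by simp
    then have "y $ E i = 0" for i by (simp add: moment_def)
    then have "moment ?e y $ a $ a = 0" for a using True by (cases a) (simp_all add: moment_def)
    then have "(moment ?e y $ a $ b)\<^sup>2 \<le> 0" for a b
      using psd_minor[OF y, of a b] by simp
    then have "moment ?e y = 0" by (simp add: vec_eq_iff)
    then show ?thesis by (simp add: inner_moment_adj)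
  next
    case False
    have "0 \<le> y $ {}" using psd_diag_nonneg[OF y, of None] by (simp add: moment_def)
    with False have pos: "0 < y $ {}" by simp
    define z where "z = (1 / y $ {}) *\<^sub>R y"
    have mz: "moment ?e z = (1 / y $ {}) *\<^sub>R moment ?e y"
      by (simp add: z_def moment_def vec_eq_iff)
    have z: "psd (moment ?e z)" "z $ {} = 1"
      using pos psd_scaleR[OF y] by (auto simp: mz) (simp add: z_def)
    have "p \<le> cost_matrix Q c \<bullet> moment ?e z"
      using p[OF SDP_feasible_of_moment(2)[OF z]]
      by (simp flip: inner_cost_matrix add: SDP_feasible_of_moment(1)[OF z])
    then have "0 \<le> C \<bullet> moment ?e z" using z(2) by (simp add: C moment_def)
    then show ?thesis using pos by (simp add: mz inner_moment_adj zero_le_divide_iff)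
  qed
  then obtain S where S: "psd S" "moment_adj ?e S = moment_adj ?e C"
    using moment_adj_separation[of ?e "moment_adj ?e C"] by blast
  have "transpose C = C"
    using Q psd_outer[of "axis (None :: 'v option) 1"]
    by (auto simp: C_def cost_matrix_def transpose_def vec_eq_iff psd_def split: option.splits)
  then have "transpose (C - S) = C - S"
    using S(1) by (simp add: psd_def transpose_def vec_eq_iff)
  moreover have "moment_adj ?e (C - S) = 0" using S(2) by (simp add: moment_adj_diff)
  ultimately obtain \<alpha> lam where m: "\<And>x X. (C - S) \<bullet> bordered x X
      + (\<Sum>i\<in>UNIV. \<alpha> i * (X $ i $ i - x $ i))
      + (\<Sum>(i, j, k, l)\<in>Jlambda E. lam i j k l * (X $ i $ j - X $ k $ l)) = 0"
    using annihilator_multipliers[of E "C - S"] E by blast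
  \<comment> \<open>(ii) and (iii) are combinations of (i) and (iv), so zero multipliers are
    admissible for them.\<close>
  have "SDP_lagrangian I E Q c \<alpha> (\<lambda>_ _. 0) (\<lambda>_ _ _. 0) lam S x X = p" for x X
    using m[of x X] by (simp add: SDP_lagrangian_def inner_diff_left C inner_cost_matrix)
  with S(1) show ?thesis by blast
qed

section \<open>Weak duality and comparison with (CP)\<close>

lemma SDP_dual_obj_le:
  assumes "psd S" "SDP_feasible I E x X"
  shows "SDP_dual_obj I E Q c \<alpha> \<beta> \<delta> lam S \<le> ereal (SDP_obj Q c x X)"
proof -
  have "SDP_dual_obj I E Q c \<alpha> \<beta> \<delta> lam S \<le> ereal (SDP_lagrangian I E Q c \<alpha> \<beta> \<delta> lam S x X)"
    unfolding SDP_dual_obj_def using assms(2)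
    by (intro INF_lower2[of "(x, X)"]) (auto simp: SDP_feasible_def)
  moreover have "0 \<le> S \<bullet> bordered x X"
    using assms by (intro psd_inner_nonneg) (auto simp: SDP_feasible_def)
  ultimately show ?thesis
    by (simp add: SDP_lagrangian_feasible[OF assms(2)]) (smt (verit) ereal_less_eq(3) order_trans)
qed

lemma SDP_dual_obj_le_g_par:
  assumes "psd S"
  shows "SDP_dual_obj I E Q c \<alpha> \<beta> \<delta> lam S \<le> ereal (g_par I E Q c \<alpha> \<beta> \<delta> lam x)"
proof -
  have "SDP_dual_obj I E Q c \<alpha> \<beta> \<delta> lam S \<le> ereal (SDP_lagrangian I E Q c \<alpha> \<beta> \<delta> lam S x (outer x))"
    unfolding SDP_dual_obj_def
    by (rule INF_lower2[of "(x, outer x)"]) (use psd_outer[of x] in \<open>auto simp: psd_def\<close>)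
  also have "\<dots> \<le> ereal (g_par I E Q c \<alpha> \<beta> \<delta> lam x)"
    using assms by (simp add: SDP_lagrangian_outer psd_def)
  finally show ?thesis .
qed

lemma CP_obj_le_SDP_obj:
  assumes "psd (Q_par I E Q \<alpha> \<beta> \<delta> lam)" "SDP_feasible I E x X"
  shows "CP_obj I E Q c \<alpha> \<beta> \<delta> lam \<le> ereal (SDP_obj Q c x X)"
  unfolding CP_obj_def
  by (rule INF_lower2[OF SDP_feasible_F_relax[OF assms(2)]]) (simp add: g_par_le_SDP_obj[OF assms(2,1)])

theorem theorem1:
  fixes I :: "'v::finite set"
    and fac :: "'v \<Rightarrow> 'v \<times> 'v"
    and E :: "'v \<Rightarrow> 'v set"
    and m :: nat
    and coef :: "nat \<Rightarrow> real"
    and M :: "nat \<Rightarrow> 'v set"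
    and Q :: "real^'v^'v"
    and c :: "real^'v"
  assumes "quadratization I fac E"
    and "\<forall>p\<in>{1..m}. M p \<subseteq> I"
    and "\<forall>p\<in>{1..m}. card (M p) \<ge> 3 \<longrightarrow> (\<exists>j k. M p = E j \<union> E k)"
    and "transpose Q = Q"
    and "\<forall>x\<in>F_bin I E. g_obj Q c x = f_obj m coef M x"
  shows "CP_value I E Q c = SDP_value I E Q c
    \<and> (\<exists>x X. SDP_optimal I E Q c x X)
    \<and> (\<exists>\<alpha> \<beta> \<delta> lam S. SDP_dual_optimal I E Q c \<alpha> \<beta> \<delta> lam S)
    \<and> (\<forall>\<alpha> \<beta> \<delta> lam S. SDP_dual_optimal I E Q c \<alpha> \<beta> \<delta> lam S
          \<longrightarrow> CP_optimal I E Q c \<alpha> \<beta> \<delta> lam)"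
proof -
  obtain x0 X0 where opt: "SDP_optimal I E Q c x0 X0"
    using SDP_optimal_exists by blast
  define p where "p = SDP_obj Q c x0 X0"
  have F: "SDP_feasible I E x0 X0" and val: "SDP_value I E Q c = ereal p"
    using opt by (simp_all add: SDP_optimal_def p_def)
  have min: "p \<le> SDP_obj Q c x X" if "SDP_feasible I E x X" for x X
  proof -
    have "SDP_value I E Q c \<le> ereal (SDP_obj Q c x X)"
      unfolding SDP_value_def using that by (intro INF_lower2[of "(x, X)"]) auto
    then show ?thesis by (simp add: val)
  qed
  obtain \<alpha>0 \<beta>0 \<delta>0 lam0 S0 where S0: "psd S0"
    and L0: "\<And>x X. SDP_lagrangian I E Q c \<alpha>0 \<beta>0 \<delta>0 lam0 S0 x X = p"
    using SDP_strong_duality[where E = E and I = I, OF quadratization_nonempty[OF assms(1)] assms(4) min]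
    by blast
  have dual0: "ereal p \<le> SDP_dual_obj I E Q c \<alpha>0 \<beta>0 \<delta>0 lam0 S0"
    unfolding SDP_dual_obj_def by (rule INF_greatest) (auto simp: L0)
  have weak: "SDP_dual_obj I E Q c \<alpha> \<beta> \<delta> lam S \<le> ereal p" if "psd S" for \<alpha> \<beta> \<delta> lam S
    using SDP_dual_obj_le[OF that F] by (simp add: p_def)
  have CP_le: "CP_obj I E Q c \<alpha> \<beta> \<delta> lam \<le> ereal p" if "psd (Q_par I E Q \<alpha> \<beta> \<delta> lam)" for \<alpha> \<beta> \<delta> lam
    using CP_obj_le_SDP_obj[OF that F] by (simp add: p_def)
  \<comment> \<open>Stated for all multipliers that reach \<open>p\<close>, since the last claim
    concerns every dual optimum and not just the constructed one.\<close>
  have attain: "psd (Q_par I E Q \<alpha> \<beta> \<delta> lam) \<and> CP_obj I E Q c \<alpha> \<beta> \<delta> lam = ereal p"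
    if "psd S" and "ereal p \<le> SDP_dual_obj I E Q c \<alpha> \<beta> \<delta> lam S" for \<alpha> \<beta> \<delta> lam S
  proof -
    have ge: "p \<le> g_par I E Q c \<alpha> \<beta> \<delta> lam x" for x
      using order_trans[OF that(2) SDP_dual_obj_le_g_par[OF that(1)], of x] by simp
    then have psdQ: "psd (Q_par I E Q \<alpha> \<beta> \<delta> lam)" by (rule psd_Q_par[OF assms(4)])
    have "ereal p \<le> CP_obj I E Q c \<alpha> \<beta> \<delta> lam"
      unfolding CP_obj_def by (rule INF_greatest) (simp add: ge)
    with CP_le[OF psdQ] psdQ show ?thesis by (simp add: order_antisym)
  qed
  have "CP_value I E Q c = ereal p"
  proof (rule antisym)
    show "CP_value I E Q c \<le> ereal p"
      unfolding CP_value_def by (rule SUP_least) (auto intro: CP_le)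
    show "ereal p \<le> CP_value I E Q c"
      unfolding CP_value_def using attain[OF S0 dual0]
      by (intro SUP_upper2[of "(\<alpha>0, \<beta>0, \<delta>0, lam0)"]) auto
  qed
  moreover have "SDP_dual_optimal I E Q c \<alpha>0 \<beta>0 \<delta>0 lam0 S0"
    unfolding SDP_dual_optimal_def using S0 weak dual0 by (blast intro: order_trans)
  moreover have "CP_optimal I E Q c \<alpha> \<beta> \<delta> lam"
    if "SDP_dual_optimal I E Q c \<alpha> \<beta> \<delta> lam S" for \<alpha> \<beta> \<delta> lam S
  proof -
    have "psd S" "ereal p \<le> SDP_dual_obj I E Q c \<alpha> \<beta> \<delta> lam S"
      using that S0 dual0 unfolding SDP_dual_optimal_def by (blast intro: order_trans)+
    then show ?thesis
      unfolding CP_optimal_def \<open>CP_value I E Q c = ereal p\<close> by (rule attain)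
  qed
  ultimately show ?thesis using opt by (simp only: val) blast
qed

end
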